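(* Let $\mathcal C_r,\mathcal C_a:\mathbb R^d\to\mathbb R^d$ be (possibly random) compressors with independent internal randomness satisfying, for all $x\in\mathbb R^d$, $$\mathbb E_{\mathcal C_r}\Big[\Big\|\frac{\mathcal C_r(x)}{r_r}-x\Big\|^2\Big]\le(1-\delta_r)\|x\|^2,\qquad \mathbb E_{\mathcal C_a}\Big[\Big\|\frac{\mathcal C_a(x)}{r_a}-x\Big\|^2\Big]\le C_a,$$ where $r_r,r_a>0$, $\delta_r\in(0,1]$, $C_a>0$. Let $\xi$ be a bounded noise with $\|\xi\|\le C_\xi$ almost surely, and define $\tilde{\mathcal C}_r(x)=\mathcal C_r(x)+\xi$ and $\tilde{\mathcal C}_a(x)=\mathcal C_a(x)+\xi$. Then $\tilde{\mathcal C}_r$ is a globally-bounded compressor with parameters $$r=r_r,\quad C=C_{\tilde r}=\frac{(2-\delta_r)C_\xi^2}{\delta_rr_r^2},\quad\delta=\frac{\delta_r}2,$$ and $\tilde{\mathcal C}_a$ is a globally-bounded compressor with parameters $$r=r_a,\quad C=C_{\tilde a}=2C_a+\frac{2C_\xi^2}{r_a^2},\quad\delta=1.$$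
   Context: A (possibly random) map $\mathcal C:\mathbb R^d\to\mathbb R^d$ is a globally-bounded compressor with parameters $r>0$, $C>0$, $\delta\in(0,1]$ if $\mathbb E_{\mathcal C}\big[\big\|\frac{\mathcal C(x)}r-x\big\|^2\big]\le(1-\delta)\|x\|^2+C$ for all $x\in\mathbb R^d$, where $\mathbb E_{\mathcal C}$ is the expectation over the internal randomness of $\mathcal C$. $\mathbb E_{\mathcal C_r},\mathbb E_{\mathcal C_a}$ are expectations over the internal randomness of $\mathcal C_r,\mathcal C_a$. Expectations are taken only over the compressors' internal randomness, not over the noise; equivalently the inequalities hold uniformly for every noise realization with $\|\xi\|\le C_\xi$. $\|\cdot\|$ is the Euclidean norm. $C_\xi>0$. *)

theory Defs
  imports "HOL-Probability.Probability"
begin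

text \<open>
  A random map is a function C of an outcome \<open>\<omega>\<close> of the internal randomness M and of the input
  vector; deterministic maps are those constant in \<open>\<omega>\<close>. The expected squared error is taken in
  the extended nonnegative reals, so that a finite upper bound on it includes integrability
  (the Bochner integral would be 0 for a non-integrable error).
\<close>

definition expected_sq_error ::
    "'w measure \<Rightarrow> ('w \<Rightarrow> real ^ 'd \<Rightarrow> real ^ 'd) \<Rightarrow> real \<Rightarrow> real ^ 'd \<Rightarrow> ennreal" where
  "expected_sq_error M C r x = (\<integral>\<^sup>+ \<omega>. ennreal ((norm (C \<omega> x /\<^sub>R r - x))\<^sup>2) \<partial>M)"

definition globally_bounded_compressor ::
    "'w measure \<Rightarrow> ('w \<Rightarrow> real ^ 'd \<Rightarrow> real ^ 'd) \<Rightarrow> real \<Rightarrow> real \<Rightarrow> real \<Rightarrow> bool" where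
  "globally_bounded_compressor M C r B \<delta> \<longleftrightarrow>
     prob_space M \<and> (\<forall>x. (\<lambda>\<omega>. C \<omega> x) \<in> borel_measurable M) \<and>
     r > 0 \<and> B > 0 \<and> 0 < \<delta> \<and> \<delta> \<le> 1 \<and>
     (\<forall>x. expected_sq_error M C r x \<le> ennreal ((1 - \<delta>) * (norm x)\<^sup>2 + B))"

end

theory Submission imports Defs begin

text \<open>
  Adding a vector \<open>v\<close> to the compressed output shifts the error by \<open>v / r\<close>. Young's inequality
  \<open>\<parallel>a + b\<parallel>\<^sup>2 \<le> (1 + t) \<parallel>a\<parallel>\<^sup>2 + (1 + 1/t) \<parallel>b\<parallel>\<^sup>2\<close> with \<open>t = \<delta> / (2 (1 - \<delta>))\<close> gives
  the relative case for \<open>\<delta> < 1\<close>, and with \<open>t = 1\<close> the absolute one. For \<open>\<delta> = 1\<close> the relative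
  error vanishes almost surely, so only the shift remains.
\<close>

text \<open>Expanding \<open>norm (t *\<^sub>R a - b)\<close> squared, which is nonnegative, and
  dividing by \<open>t\<close> bounds the cross term \<open>2 * (a \<bullet> b)\<close>.\<close>

lemma young_norm_add_sq:
  fixes a b :: "'a::real_inner"
  assumes "t > 0"
  shows "(norm (a + b))\<^sup>2 \<le> (1 + t) * (norm a)\<^sup>2 + (1 + 1 / t) * (norm b)\<^sup>2"
proof -
  have "0 \<le> (norm (t *\<^sub>R a - b))\<^sup>2 / t"
    using assms by simp
  also have "\<dots> = t * (norm a)\<^sup>2 + (norm b)\<^sup>2 / t - 2 * (a \<bullet> b)"
    using assms unfolding power2_norm_eq_inner
    by (simp add: inner_diff_left inner_diff_right inner_commute[of b a] field_simps)
  finally show ?thesis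
    by (simp add: power2_norm_eq_inner inner_add_left inner_add_right inner_commute algebra_simps)
qed

text \<open>Young's inequality holds for each outcome and is then integrated; the constant survives
  unchanged because \<open>M\<close> has total mass 1. The weight \<open>t\<close> stays free since
  the relative and the absolute case choose it differently.\<close>

lemma expected_sq_error_add_le:
  fixes C :: "'w \<Rightarrow> real ^ 'd \<Rightarrow> real ^ 'd"
  assumes "prob_space M" and meas: "(\<lambda>\<omega>. C \<omega> x) \<in> borel_measurable M"
    and "t > 0" and "0 \<le> e" and err: "expected_sq_error M C r x \<le> ennreal e"
  shows "expected_sq_error M (\<lambda>\<omega> x. C \<omega> x + v) r x
           \<le> ennreal ((1 + t) * e + (1 + 1 / t) * (norm (v /\<^sub>R r))\<^sup>2)"
proof -
  interpret prob_space M by fact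
  define K where "K = (1 + 1 / t) * (norm (v /\<^sub>R r))\<^sup>2"
  have K: "0 \<le> K" using \<open>t > 0\<close> by (simp add: K_def)
  have "expected_sq_error M (\<lambda>\<omega> x. C \<omega> x + v) r x
          \<le> (\<integral>\<^sup>+ \<omega>. ennreal (1 + t) * ennreal ((norm (C \<omega> x /\<^sub>R r - x))\<^sup>2) + ennreal K \<partial>M)"
    unfolding expected_sq_error_def
  proof (rule nn_integral_mono)
    fix \<omega>
    have "(norm ((C \<omega> x + v) /\<^sub>R r - x))\<^sup>2 = (norm ((C \<omega> x /\<^sub>R r - x) + v /\<^sub>R r))\<^sup>2"
      by (simp add: scaleR_add_right add_diff_eq diff_add_eq)
    also have "\<dots> \<le> (1 + t) * (norm (C \<omega> x /\<^sub>R r - x))\<^sup>2 + K"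
      unfolding K_def by (rule young_norm_add_sq) fact
    finally show "ennreal ((norm ((C \<omega> x + v) /\<^sub>R r - x))\<^sup>2)
        \<le> ennreal (1 + t) * ennreal ((norm (C \<omega> x /\<^sub>R r - x))\<^sup>2) + ennreal K"
      \<comment> \<open>Merging the \<open>ennreal\<close> factors and summands into one real
        expression requires their nonnegativity, hence \<open>K\<close> and the sign of
        \<open>t\<close>.\<close>
      using \<open>t > 0\<close> K by (simp flip: ennreal_mult ennreal_plus add: ennreal_leI)
  qed
  also have "\<dots> = ennreal (1 + t) * expected_sq_error M C r x + ennreal K"
    unfolding expected_sq_error_def using meas
    by (simp add: nn_integral_add nn_integral_cmult emeasure_space_1)
  also have "\<dots> \<le> ennreal (1 + t) * ennreal e + ennreal K"
    by (intro add_mono mult_left_mono err) auto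
  also have "\<dots> = ennreal ((1 + t) * e + K)"
    using \<open>t > 0\<close> \<open>0 \<le> e\<close> K by (simp flip: ennreal_mult ennreal_plus)
  finally show ?thesis by (simp add: K_def)
qed

text \<open>A nonnegative function with zero integral vanishes almost everywhere, so the error after
  the shift is almost surely the constant \<open>v /\<^sub>R r\<close>. This serves \<delta> = 1,
  where the formula for the Young weight divides by zero.\<close>

lemma expected_sq_error_add_exact:
  fixes C :: "'w \<Rightarrow> real ^ 'd \<Rightarrow> real ^ 'd"
  assumes "prob_space M" and meas: "(\<lambda>\<omega>. C \<omega> x) \<in> borel_measurable M"
    and err: "expected_sq_error M C r x = 0"
  shows "expected_sq_error M (\<lambda>\<omega> x. C \<omega> x + v) r x = ennreal ((norm (v /\<^sub>R r))\<^sup>2)"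
proof -
  interpret prob_space M by fact
  have "AE \<omega> in M. ennreal ((norm (C \<omega> x /\<^sub>R r - x))\<^sup>2) = 0"
    using err meas unfolding expected_sq_error_def by (subst (asm) nn_integral_0_iff_AE) auto
  then have "AE \<omega> in M. (C \<omega> x + v) /\<^sub>R r - x = v /\<^sub>R r"
    by eventually_elim (simp add: scaleR_add_right)
  then have "expected_sq_error M (\<lambda>\<omega> x. C \<omega> x + v) r x
      = (\<integral>\<^sup>+ \<omega>. ennreal ((norm (v /\<^sub>R r))\<^sup>2) \<partial>M)"
    unfolding expected_sq_error_def by (intro nn_integral_cong_AE) auto
  then show ?thesis by (simp add: emeasure_space_1)
qed

lemma norm_scaleR_inverse_sq_le:
  fixes v :: "'a::real_normed_vector"
  assumes "norm v \<le> c"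
  shows "(norm (v /\<^sub>R r))\<^sup>2 \<le> c\<^sup>2 / r\<^sup>2"
proof -
  \<comment> \<open>Squaring removes the sign of \<open>r\<close>, and at \<open>r = 0\<close> both
    sides are 0 since \<open>inverse 0 = 0\<close>.\<close>
  have "(norm (v /\<^sub>R r))\<^sup>2 = (norm v)\<^sup>2 / r\<^sup>2"
    by (simp add: power_mult_distrib power_inverse divide_inverse mult.commute)
  also have "\<dots> \<le> c\<^sup>2 / r\<^sup>2"
    using assms by (intro divide_right_mono power_mono) auto
  finally show ?thesis .
qed

lemma relative_compressor_add_bounded:
  fixes C :: "'w \<Rightarrow> real ^ 'd \<Rightarrow> real ^ 'd"
  assumes M: "prob_space M" and meas: "\<And>x. (\<lambda>\<omega>. C \<omega> x) \<in> borel_measurable M"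
    and r: "r > 0" and \<delta>: "0 < \<delta>" "\<delta> \<le> 1" and c: "c > 0"
    and err: "\<And>x. expected_sq_error M C r x \<le> ennreal ((1 - \<delta>) * (norm x)\<^sup>2)"
    and v: "norm v \<le> c"
  shows "globally_bounded_compressor M (\<lambda>\<omega> x. C \<omega> x + v)
           r ((2 - \<delta>) * c\<^sup>2 / (\<delta> * r\<^sup>2)) (\<delta> / 2)"
proof -
  have "expected_sq_error M (\<lambda>\<omega> x. C \<omega> x + v) r x
      \<le> ennreal ((1 - \<delta> / 2) * (norm x)\<^sup>2 + (2 - \<delta>) * c\<^sup>2 / (\<delta> * r\<^sup>2))" for x
  proof (cases "\<delta> = 1")
    case True
    then have "expected_sq_error M C r x = 0" using err[of x] by simp
    then have "expected_sq_error M (\<lambda>\<omega> x. C \<omega> x + v) r x = ennreal ((norm (v /\<^sub>R r))\<^sup>2)"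
      using M meas by (rule expected_sq_error_add_exact[rotated 2])
    also have "\<dots> \<le> ennreal ((1 - \<delta> / 2) * (norm x)\<^sup>2 + (2 - \<delta>) * c\<^sup>2 / (\<delta> * r\<^sup>2))"
      \<comment> \<open>At \<delta> = 1 the additive constant is exactly
        \<open>c\<^sup>2 / r\<^sup>2\<close>; the remaining half of \<open>(norm x)\<^sup>2\<close>
        is nonnegative slack.\<close>
      using norm_scaleR_inverse_sq_le[OF v, of r] True
      by (intro ennreal_leI) (simp add: add_increasing)
    finally show ?thesis .
  next
    case False
    \<comment> \<open>This is the solution of
      \<open>(1 + t) * (1 - \<delta>) = 1 - \<delta> / 2\<close>: the contraction gives up half of
      \<delta>, and the factor \<open>1 + 1 / t\<close> of the noise is then forced to be
      \<open>(2 - \<delta>) / \<delta>\<close>.\<close>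
    define t where "t = \<delta> / (2 * (1 - \<delta>))"
    have t: "t > 0" using False \<delta> by (simp add: t_def)
    have t1: "(1 + t) * (1 - \<delta>) = 1 - \<delta> / 2" and t2: "1 + 1 / t = (2 - \<delta>) / \<delta>"
      using False \<delta> by (simp_all add: t_def field_simps)
    have "expected_sq_error M (\<lambda>\<omega> x. C \<omega> x + v) r x
        \<le> ennreal ((1 + t) * ((1 - \<delta>) * (norm x)\<^sup>2) + (1 + 1 / t) * (norm (v /\<^sub>R r))\<^sup>2)"
      using \<delta> by (intro expected_sq_error_add_le M meas t err) simp
    also have "\<dots> = ennreal ((1 - \<delta> / 2) * (norm x)\<^sup>2 + (2 - \<delta>) / \<delta> * (norm (v /\<^sub>R r))\<^sup>2)"
      by (simp only: t1 t2 flip: mult.assoc)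
    also have "\<dots> \<le> ennreal ((1 - \<delta> / 2) * (norm x)\<^sup>2 + (2 - \<delta>) / \<delta> * (c\<^sup>2 / r\<^sup>2))"
      using \<delta> by (intro ennreal_leI add_left_mono mult_left_mono norm_scaleR_inverse_sq_le v) simp
    finally show ?thesis by simp
  qed
  then show ?thesis
    using M meas r \<delta> c unfolding globally_bounded_compressor_def
    by (auto intro!: borel_measurable_add)
qed

lemma absolute_compressor_add_bounded:
  fixes C :: "'w \<Rightarrow> real ^ 'd \<Rightarrow> real ^ 'd"
  assumes M: "prob_space M" and meas: "\<And>x. (\<lambda>\<omega>. C \<omega> x) \<in> borel_measurable M"
    and r: "r > 0" and B: "B > 0"
    and err: "\<And>x. expected_sq_error M C r x \<le> ennreal B"
    and v: "norm v \<le> c"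
  shows "globally_bounded_compressor M (\<lambda>\<omega> x. C \<omega> x + v) r (2 * B + 2 * c\<^sup>2 / r\<^sup>2) 1"
proof -
  have "expected_sq_error M (\<lambda>\<omega> x. C \<omega> x + v) r x \<le> ennreal (2 * B + 2 * c\<^sup>2 / r\<^sup>2)" for x
  proof -
    have "expected_sq_error M (\<lambda>\<omega> x. C \<omega> x + v) r x
        \<le> ennreal ((1 + 1) * B + (1 + 1 / 1) * (norm (v /\<^sub>R r))\<^sup>2)"
      using B by (intro expected_sq_error_add_le M meas err) simp_all
    also have "\<dots> \<le> ennreal (2 * B + 2 * c\<^sup>2 / r\<^sup>2)"
      using norm_scaleR_inverse_sq_le[OF v, of r] by (intro ennreal_leI) simp
    finally show ?thesis .
  qed
  moreover have "0 < 2 * B + 2 * c\<^sup>2 / r\<^sup>2"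
    using B by (intro add_pos_nonneg) auto
  ultimately show ?thesis
    using M meas r unfolding globally_bounded_compressor_def
    by (auto intro!: borel_measurable_add)
qed

text \<open>Expectations run over \<open>M\<close> only, so a noise realization enters as a fixed
  vector \<open>v\<close>, and both compressor bounds are shown for every \<open>v\<close> in the
  ball of radius \<open>C\<^sub>\<xi>\<close>.\<close>

theorem lemma1:
  fixes M :: "'w measure" and N :: "'n measure"
    and \<C>\<^sub>r \<C>\<^sub>a :: "'w \<Rightarrow> real ^ 'd \<Rightarrow> real ^ 'd"
    and \<xi> :: "'n \<Rightarrow> real ^ 'd"
    and r\<^sub>r r\<^sub>a \<delta>\<^sub>r C\<^sub>a C\<^sub>\<xi> :: real
  assumes "prob_space M" and "prob_space N"
    and "prob_space.indep_var M (Pi\<^sub>M UNIV (\<lambda>_. borel)) \<C>\<^sub>r (Pi\<^sub>M UNIV (\<lambda>_. borel)) \<C>\<^sub>a"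
    and "r\<^sub>r > 0" and "r\<^sub>a > 0" and "0 < \<delta>\<^sub>r" and "\<delta>\<^sub>r \<le> 1" and "C\<^sub>a > 0" and "C\<^sub>\<xi> > 0"
    and "\<And>x. expected_sq_error M \<C>\<^sub>r r\<^sub>r x \<le> ennreal ((1 - \<delta>\<^sub>r) * (norm x)\<^sup>2)"
    and "\<And>x. expected_sq_error M \<C>\<^sub>a r\<^sub>a x \<le> ennreal C\<^sub>a"
    and "\<xi> \<in> borel_measurable N"
    and "AE \<nu> in N. norm (\<xi> \<nu>) \<le> C\<^sub>\<xi>"
  defines "good \<equiv> \<lambda>v.
      globally_bounded_compressor M (\<lambda>\<omega> x. \<C>\<^sub>r \<omega> x + v)
        r\<^sub>r ((2 - \<delta>\<^sub>r) * C\<^sub>\<xi>\<^sup>2 / (\<delta>\<^sub>r * r\<^sub>r\<^sup>2)) (\<delta>\<^sub>r / 2) \<and>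
      globally_bounded_compressor M (\<lambda>\<omega> x. \<C>\<^sub>a \<omega> x + v)
        r\<^sub>a (2 * C\<^sub>a + 2 * C\<^sub>\<xi>\<^sup>2 / r\<^sub>a\<^sup>2) 1"
  shows "(\<forall>\<nu>\<in>space N. norm (\<xi> \<nu>) \<le> C\<^sub>\<xi> \<longrightarrow> good (\<xi> \<nu>)) \<and> (AE \<nu> in N. good (\<xi> \<nu>))"
proof -
  interpret M: prob_space M by fact
  \<comment> \<open>Independence of the two random functions includes their measurability into the
    product space; evaluation at \<open>x\<close> is a coordinate projection, which yields
    measurability for each fixed input.\<close>
  have rv: "\<C>\<^sub>r \<in> measurable M (Pi\<^sub>M UNIV (\<lambda>_. borel))"
    "\<C>\<^sub>a \<in> measurable M (Pi\<^sub>M UNIV (\<lambda>_. borel))"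
    using M.indep_var_rv1[OF assms(3)] M.indep_var_rv2[OF assms(3)] .
  have meas: "(\<lambda>\<omega>. \<C>\<^sub>r \<omega> x) \<in> borel_measurable M" "(\<lambda>\<omega>. \<C>\<^sub>a \<omega> x) \<in> borel_measurable M" for x
    using rv[THEN measurable_compose, OF measurable_component_singleton[of x]] by simp_all
  have good: "good v" if "norm v \<le> C\<^sub>\<xi>" for v
    unfolding good_def using assms that
    by (intro conjI relative_compressor_add_bounded absolute_compressor_add_bounded meas) auto
  show ?thesis
    using good assms(13) by auto
qed

end
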